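(* Let $G$ be a group endowed with a topology in which singletons are closed and such that for every $a\in G$ the functions $G\to G$ given by $x\mapsto x^{-1}$, $x\mapsto ax$, $x\mapsto xa$ and $x\mapsto x^{-1}ax$ are continuous. Let $H\leq G$ be a subgroup. If $G$ satisfies the minimal condition on closed subgroups (i.e. every descending chain of closed subgroups of $G$ becomes constant after finitely many steps), then the chain $(E_k(H))_{k\in\mathbb{N}}$ stabilizes, i.e. there is $n\in\mathbb{N}$ such that $E_m(H)=E_n(H)$ for all $m\geq n$.
   Context: Commutators are $[g,h]=g^{-1}h^{-1}gh$, and for an element $g$ and a subset $S$ of a group, $[g,S]=\{[g,s]\mid s\in S\}$. Iterated centralizers: for a group $G$ and a subset $A\subseteq G$, set $C_G^0(A)=1$ and for $k\geq 1$ $$C_G^k(A)=\Big\{x\in\bigcap_{n<k}N_G\big(C_G^n(A)\big)\;\Big|\;[x,A]\subseteq C_G^{k-1}(A)\Big\},$$ where $N_G$ denotes the normalizer in $G$. These are subgroups of $G$. Envelopes: for a group $G$ and a subgroup $H\leq G$, set $E_0(H)=G$ and for $k\geq 0$ $$E_{k+1}(H)=\Big\{g\in E_k(H)\;\Big|\;\big[g,C_{E_k(H)}^{k+1}(H)\big]\subseteq C_{E_k(H)}^{k}(H)\Big\},$$ where the iterated centralizers are computed in the group $E_k(H)$. These form a descending chain of subgroups $G=E_0(H)\geq E_1(H)\geq\cdots\geq H$. *)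

theory Defs
  imports "HOL-Algebra.Group_Action" "HOL-Analysis.Abstract_Topology"
begin

definition commutator :: "('a, 'b) monoid_scheme \<Rightarrow> 'a \<Rightarrow> 'a \<Rightarrow> 'a" where
  "commutator G g h = inv\<^bsub>G\<^esub> g \<otimes>\<^bsub>G\<^esub> inv\<^bsub>G\<^esub> h \<otimes>\<^bsub>G\<^esub> g \<otimes>\<^bsub>G\<^esub> h"

definition commutator_set :: "('a, 'b) monoid_scheme \<Rightarrow> 'a \<Rightarrow> 'a set \<Rightarrow> 'a set" where
  "commutator_set G g S = commutator G g ` S"

fun iterated_centralizer :: "('a, 'b) monoid_scheme \<Rightarrow> 'a set \<Rightarrow> nat \<Rightarrow> 'a set" where
  "iterated_centralizer G A 0 = {\<one>\<^bsub>G\<^esub>}"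
| "iterated_centralizer G A (Suc k) =
     {x \<in> (\<Inter>n\<in>{..<Suc k}. normalizer G (iterated_centralizer G A n)).
        commutator_set G x A \<subseteq> iterated_centralizer G A k}"

(* The envelopes are subsets of the carrier of G; "computed in the group E_k(H)" is rendered by
   restricting the carrier of G to E_k(H). *)
primrec envelope :: "('a, 'b) monoid_scheme \<Rightarrow> 'a set \<Rightarrow> nat \<Rightarrow> 'a set" where
  "envelope G H 0 = carrier G"
| "envelope G H (Suc k) =
     {g \<in> envelope G H k.
        commutator_set G g (iterated_centralizer (G\<lparr>carrier := envelope G H k\<rparr>) H (Suc k))
          \<subseteq> iterated_centralizer (G\<lparr>carrier := envelope G H k\<rparr>) H k}"

definition min_condition_closed_subgroups ::
    "('a, 'b) monoid_scheme \<Rightarrow> 'a topology \<Rightarrow> bool" where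
  "min_condition_closed_subgroups G T \<longleftrightarrow>
     (\<forall>K :: nat \<Rightarrow> 'a set.
        (\<forall>n. subgroup (K n) G \<and> closedin T (K n)) \<and> (\<forall>n. K (Suc n) \<subseteq> K n)
          \<longrightarrow> (\<exists>n. \<forall>m\<ge>n. K m = K n))"

end

theory Submission
  imports Defs
begin

text \<open>
  The envelopes turn out to be closed subgroups of \<open>G\<close>, so the minimal condition applies to the
  chain of envelopes itself.

  What makes \<open>E\<^sub>k\<^sub>+\<^sub>1\<close> a subgroup is the fact that the first \<open>k\<close> iterated centralizers of \<open>H\<close> in
  \<open>E\<^sub>k\<close> cannot be told apart from those of the whole group \<open>E\<^sub>k\<close>: for \<open>n \<le> k\<close> the \<open>n\<close>-th one is the
  \<open>n\<close>-th centre \<open>Z\<^sub>n(E\<^sub>k)\<close> (\<open>envelope_invariant\<close>, with its inductive step in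
  \<open>iterated_centralizer_centralizer_mod\<close>).  In particular \<open>Z = Z\<^sub>k(E\<^sub>k)\<close> is normal in \<open>E\<^sub>k\<close>.  So
  the \<open>k+1\<close>-st iterated centralizer \<open>C\<close> is the set of elements of \<open>E\<^sub>k\<close> that centralize \<open>H\<close>
  modulo \<open>Z\<close>, and \<open>E\<^sub>k\<^sub>+\<^sub>1\<close> is the set of elements of \<open>E\<^sub>k\<close> that centralize \<open>C\<close> modulo \<open>Z\<close>: up to
  \<open>Z\<close> the passage from \<open>H\<close> to \<open>E\<^sub>k\<^sub>+\<^sub>1\<close> is the double centralizer.  Whatever centralizes \<open>H\<close> modulo
  \<open>Z\<close> and survives in \<open>E\<^sub>k\<^sub>+\<^sub>1\<close> therefore centralizes all of \<open>E\<^sub>k\<^sub>+\<^sub>1\<close> modulo \<open>Z\<close>, which gives the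
  equality with the centres one step further.

  For closedness, the map \<open>x \<mapsto> [x, s]\<close> is a conjugation map \<open>x \<mapsto> x\<^sup>-\<^sup>1 s\<^sup>-\<^sup>1 x\<close> followed by a right
  translation.  Hence centralizers modulo a closed subgroup are closed; starting from the closed
  trivial subgroup this covers first the centres of a closed subgroup and then the envelopes.
\<close>

section \<open>Centralizers modulo a normal subgroup\<close>

text \<open>
  If \<open>N\<close> is normal, this is the preimage of the centralizer of the image of \<open>S\<close> in the quotient by
  \<open>N\<close>.  It is the common form of the steps that lead to the upper centres and to the envelopes.
\<close>

definition centralizer_mod :: "('a, 'b) monoid_scheme \<Rightarrow> 'a set \<Rightarrow> 'a set \<Rightarrow> 'a set" where
  "centralizer_mod G N S = {x \<in> carrier G. \<forall>s\<in>S. commutator G x s \<in> N}"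

lemma centralizer_mod_antimono:
  "S \<subseteq> S' \<Longrightarrow> centralizer_mod G N S' \<subseteq> centralizer_mod G N S"
  unfolding centralizer_mod_def by blast

context group
begin

lemma inv_mult_cancel_left:
  assumes "x \<in> carrier G" "y \<in> carrier G"
  shows "inv x \<otimes> (x \<otimes> y) = y" and "x \<otimes> (inv x \<otimes> y) = y"
  using assms by (simp_all flip: m_assoc)

lemmas group_word_simps = m_assoc inv_mult_group inv_mult_cancel_left

lemma commutator_swap_mem:
  assumes "subgroup N G" "x \<in> carrier G" "y \<in> carrier G" "commutator G x y \<in> N"
  shows "commutator G y x \<in> N"
proof -
  have "commutator G y x = inv (commutator G x y)"
    using assms(2,3) unfolding commutator_def by (simp add: group_word_simps)
  then show ?thesis
    using assms(1,4) by (simp add: subgroup.m_inv_closed)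
qed

lemma commutator_restrict:
  assumes "subgroup F G" "x \<in> F" "y \<in> F"
  shows "commutator (G\<lparr>carrier := F\<rparr>) x y = commutator G x y"
  using assms by (simp add: commutator_def)

lemma centralizer_mod_restrict:
  assumes "subgroup F G" "S \<subseteq> F"
  shows "centralizer_mod (G\<lparr>carrier := F\<rparr>) N S = F \<inter> centralizer_mod G N S"
  using assms subgroup.subset[OF assms(1)]
  by (auto simp: centralizer_mod_def commutator_restrict subset_iff)

text \<open>
  Normality enters through \<open>[xy, s] = y\<^sup>-\<^sup>1[x, s]y \<cdot> [y, s]\<close>: the first factor is a conjugate of an
  element of \<open>N\<close>.
\<close>

lemma subgroup_centralizer_mod:
  assumes "N \<lhd> G" "S \<subseteq> carrier G"
  shows "subgroup (centralizer_mod G N S) G"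
proof -
  interpret N: normal N G by fact
  show ?thesis
  proof
    show "centralizer_mod G N S \<subseteq> carrier G"
      by (auto simp: centralizer_mod_def)
  next
    fix x y assume xy: "x \<in> centralizer_mod G N S" "y \<in> centralizer_mod G N S"
    have c: "x \<in> carrier G" "y \<in> carrier G" using xy by (auto simp: centralizer_mod_def)
    have "commutator G (x \<otimes> y) s \<in> N" if s: "s \<in> S" for s
    proof -
      have sc: "s \<in> carrier G" using s assms(2) by blast
      have "commutator G (x \<otimes> y) s = (inv y \<otimes> commutator G x s \<otimes> y) \<otimes> commutator G y s"
        using c sc unfolding commutator_def by (simp add: group_word_simps)
      then show ?thesis
        using xy s c by (simp add: centralizer_mod_def N.inv_op_closed1)
    qed
    then show "x \<otimes> y \<in> centralizer_mod G N S"
      using c by (simp add: centralizer_mod_def)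
  next
    show "\<one> \<in> centralizer_mod G N S"
      using assms(2) by (auto simp: centralizer_mod_def commutator_def subset_iff)
  next
    fix x assume x: "x \<in> centralizer_mod G N S"
    have c: "x \<in> carrier G" using x by (auto simp: centralizer_mod_def)
    have "commutator G (inv x) s \<in> N" if s: "s \<in> S" for s
    proof -
      have sc: "s \<in> carrier G" using s assms(2) by blast
      have "commutator G (inv x) s = x \<otimes> inv (commutator G x s) \<otimes> inv x"
        using c sc unfolding commutator_def by (simp add: group_word_simps)
      then show ?thesis
        using x s c by (simp add: centralizer_mod_def N.inv_op_closed2)
    qed
    then show "inv x \<in> centralizer_mod G N S"
      using c by (simp add: centralizer_mod_def)
  qed
qed

lemma normal_centralizer_mod_carrier:
  assumes "N \<lhd> G"
  shows "centralizer_mod G N (carrier G) \<lhd> G"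
proof -
  interpret N: normal N G by fact
  have "g \<otimes> x \<otimes> inv g \<in> centralizer_mod G N (carrier G)"
    if g: "g \<in> carrier G" and x: "x \<in> centralizer_mod G N (carrier G)" for g x
  proof -
    have c: "x \<in> carrier G" using x by (auto simp: centralizer_mod_def)
    have "commutator G (g \<otimes> x \<otimes> inv g) s \<in> N" if s: "s \<in> carrier G" for s
    proof -
      have "commutator G (g \<otimes> x \<otimes> inv g) s = g \<otimes> commutator G x (inv g \<otimes> s \<otimes> g) \<otimes> inv g"
        using c s g unfolding commutator_def by (simp add: group_word_simps)
      then show ?thesis
        using x s g by (simp add: centralizer_mod_def N.inv_op_closed2)
    qed
    then show ?thesis
      using c g by (simp add: centralizer_mod_def)
  qed
  then show ?thesis
    using subgroup_centralizer_mod[OF assms] by (simp add: normal_inv_iff)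
qed

lemma normal_subset_centralizer_mod:
  assumes "N \<lhd> G" "S \<subseteq> carrier G"
  shows "N \<subseteq> centralizer_mod G N S"
proof
  interpret N: normal N G by fact
  fix x assume x: "x \<in> N"
  have "commutator G x s \<in> N" if s: "s \<in> S" for s
  proof -
    have sc: "s \<in> carrier G" using s assms(2) by blast
    have "commutator G x s = inv x \<otimes> (inv s \<otimes> x \<otimes> s)"
      using x sc unfolding commutator_def by (simp add: m_assoc)
    then show ?thesis
      using x sc by (simp add: N.inv_op_closed1)
  qed
  then show "x \<in> centralizer_mod G N S"
    using x by (simp add: centralizer_mod_def)
qed

lemma normalizer_of_normal:
  assumes "N \<lhd> G"
  shows "normalizer G N = carrier G"
proof -
  interpret N: normal N G by fact
  have "g <# N #> inv g = N" if g: "g \<in> carrier G" for g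
    using g N.coset_eq[rule_format, OF g, symmetric] N.subset by (simp add: coset_mult_assoc)
  then show ?thesis
    using N.subset by (auto simp: normalizer_def stabilizer_def)
qed

end

section \<open>The upper central series and iterated centralizers\<close>

fun upper_central :: "('a, 'b) monoid_scheme \<Rightarrow> nat \<Rightarrow> 'a set" where
  "upper_central G 0 = {\<one>\<^bsub>G\<^esub>}"
| "upper_central G (Suc n) = centralizer_mod G (upper_central G n) (carrier G)"

context group
begin

lemma upper_central_normal: "upper_central G n \<lhd> G"
  by (induction n) (simp_all add: one_is_normal normal_centralizer_mod_carrier)

lemma upper_central_mono: "m \<le> n \<Longrightarrow> upper_central G m \<subseteq> upper_central G n"
  by (rule lift_Suc_mono_le)
    (simp_all add: normal_subset_centralizer_mod upper_central_normal)

text \<open>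
  The upper centres are normal, so as long as the iterated centralizers agree with them, every
  element of the group satisfies the normalizer condition in their definition.
\<close>

lemma iterated_centralizer_Suc:
  assumes "\<And>j. j \<le> n \<Longrightarrow> iterated_centralizer G A j = upper_central G j"
  shows "iterated_centralizer G A (Suc n) = centralizer_mod G (upper_central G n) A"
proof -
  have "normalizer G (iterated_centralizer G A j) = carrier G" if "j < Suc n" for j
    using that assms by (simp add: normalizer_of_normal upper_central_normal)
  then have "(\<Inter>j\<in>{..<Suc n}. normalizer G (iterated_centralizer G A j)) = carrier G"
    by auto
  then show ?thesis
    using assms[of n] by (auto simp: centralizer_mod_def commutator_set_def)
qed

text \<open>
  The double centralizer \<open>F\<close> of \<open>H\<close> modulo \<open>Z = upper_central G k\<close> contains \<open>Z\<close>, so nothing is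
  lost below level \<open>k\<close> when \<open>G\<close> is replaced by \<open>F\<close>; and at level \<open>k + 1\<close> the elements of \<open>F\<close> that
  centralize \<open>H\<close> modulo \<open>Z\<close> are exactly those that every element of \<open>F\<close> was required to commute
  with modulo \<open>Z\<close>.
\<close>

lemma iterated_centralizer_centralizer_mod:
  fixes k :: nat and H :: "'a set"
  defines "F \<equiv> centralizer_mod G (upper_central G k) (iterated_centralizer G H (Suc k))"
  assumes H: "H \<subseteq> carrier G"
    and eq: "\<And>j. j \<le> k \<Longrightarrow> iterated_centralizer G H j = upper_central G j"
  shows "subgroup F G" and "H \<subseteq> F"
    and "\<And>j. j \<le> Suc k \<Longrightarrow>
           iterated_centralizer (G\<lparr>carrier := F\<rparr>) H j = upper_central (G\<lparr>carrier := F\<rparr>) j"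
proof -
  let ?K = "G\<lparr>carrier := F\<rparr>"
  let ?Z = "upper_central G"
  define C where "C = iterated_centralizer G H (Suc k)"
  have C: "C = centralizer_mod G (?Z k) H"
    unfolding C_def by (rule iterated_centralizer_Suc) (rule eq)
  have F: "F = centralizer_mod G (?Z k) C"
    by (simp only: F_def C_def)
  have CG: "C \<subseteq> carrier G"
    unfolding C by (auto simp: centralizer_mod_def)
  have Z_subgroup: "subgroup (?Z n) G" for n
    by (rule normal_imp_subgroup[OF upper_central_normal])
  show sub: "subgroup F G"
    unfolding F by (rule subgroup_centralizer_mod[OF upper_central_normal CG])
  show HF: "H \<subseteq> F"
    using H commutator_swap_mem[OF Z_subgroup] by (auto simp: F C centralizer_mod_def)
  interpret K: group ?K
    by (rule subgroup_imp_group[OF sub])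
  have ZF: "?Z n \<subseteq> F" if "n \<le> k" for n
    using upper_central_mono[OF that] normal_subset_centralizer_mod[OF upper_central_normal CG]
    unfolding F by blast
  have low: "\<forall>j\<le>n. iterated_centralizer ?K H j = ?Z j \<and> upper_central ?K j = ?Z j"
    if "n \<le> k" for n
    using that
  proof (induction n)
    case 0
    then show ?case by simp
  next
    case (Suc n)
    then have IH: "\<And>j. j \<le> n \<Longrightarrow> iterated_centralizer ?K H j = ?Z j"
        "\<And>j. j \<le> n \<Longrightarrow> upper_central ?K j = ?Z j"
      by simp_all
    have "iterated_centralizer ?K H (Suc n) = centralizer_mod ?K (upper_central ?K n) H"
      using IH by (intro K.iterated_centralizer_Suc) simp
    also have "\<dots> = F \<inter> centralizer_mod G (?Z n) H"
      using centralizer_mod_restrict[OF sub HF] IH(2) by simp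
    also have "centralizer_mod G (?Z n) H = ?Z (Suc n)"
      using iterated_centralizer_Suc[of n H] eq Suc.prems by (metis Suc_leD le_trans)
    also have "F \<inter> ?Z (Suc n) = ?Z (Suc n)"
      using ZF Suc.prems by blast
    finally have it: "iterated_centralizer ?K H (Suc n) = ?Z (Suc n)" .
    have up: "upper_central ?K (Suc n) = F \<inter> centralizer_mod G (?Z n) F"
      using centralizer_mod_restrict[OF sub order_refl] IH(2) by simp
    \<comment> \<open>Testing commutators against \<open>F\<close> lies between testing against \<open>carrier G\<close> and against \<open>H\<close>,
      and these two extremes agree.\<close>
    have "?Z (Suc n) \<subseteq> centralizer_mod G (?Z n) F"
      using centralizer_mod_antimono[OF subgroup.subset[OF sub]] by simp
    moreover have "centralizer_mod G (?Z n) F \<subseteq> ?Z (Suc n)"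
      using centralizer_mod_antimono[OF HF] \<open>centralizer_mod G (?Z n) H = ?Z (Suc n)\<close> by blast
    ultimately have "upper_central ?K (Suc n) = ?Z (Suc n)"
      using up ZF[OF Suc.prems] by blast
    with it IH show ?case
      by (metis le_Suc_eq)
  qed
  have top: "iterated_centralizer ?K H (Suc k) = upper_central ?K (Suc k)"
  proof -
    have low': "iterated_centralizer ?K H j = ?Z j" "upper_central ?K j = ?Z j" if "j \<le> k" for j
      using low that by blast+
    have "iterated_centralizer ?K H (Suc k) = centralizer_mod ?K (upper_central ?K k) H"
      using low' by (intro K.iterated_centralizer_Suc) simp
    also have "\<dots> = F \<inter> C"
      using centralizer_mod_restrict[OF sub HF] low' by (simp add: C)
    finally have it: "iterated_centralizer ?K H (Suc k) = F \<inter> C" .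
    have up: "upper_central ?K (Suc k) = F \<inter> centralizer_mod G (?Z k) F"
      using centralizer_mod_restrict[OF sub order_refl] low' by simp
    have "C \<subseteq> centralizer_mod G (?Z k) F"
      using CG commutator_swap_mem[OF Z_subgroup] by (auto simp: F centralizer_mod_def)
    moreover have "centralizer_mod G (?Z k) F \<subseteq> C"
      unfolding C by (rule centralizer_mod_antimono[OF HF])
    ultimately show ?thesis
      using it up by blast
  qed
  show "iterated_centralizer ?K H j = upper_central ?K j" if "j \<le> Suc k" for j
    using that low[of k] top by (metis le_Suc_eq order_refl)
qed

section \<open>Envelopes\<close>

lemma envelope_Suc_eq_centralizer_mod:
  assumes "iterated_centralizer (G\<lparr>carrier := envelope G H k\<rparr>) H k = N"
    and "subgroup (envelope G H k) G"
    and "iterated_centralizer (G\<lparr>carrier := envelope G H k\<rparr>) H (Suc k) \<subseteq> envelope G H k"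
  shows "envelope G H (Suc k) =
    centralizer_mod (G\<lparr>carrier := envelope G H k\<rparr>) N
      (iterated_centralizer (G\<lparr>carrier := envelope G H k\<rparr>) H (Suc k))"
  using assms
  by (auto simp: centralizer_mod_def commutator_set_def commutator_restrict subset_iff
      simp del: iterated_centralizer.simps)

lemma envelope_invariant:
  assumes "subgroup H G"
  shows "subgroup (envelope G H k) G \<and> H \<subseteq> envelope G H k \<and>
    (\<forall>j\<le>k. iterated_centralizer (G\<lparr>carrier := envelope G H k\<rparr>) H j =
            upper_central (G\<lparr>carrier := envelope G H k\<rparr>) j)"
proof (induction k)
  case 0
  then show ?case
    using subgroup.subset[OF assms] by (simp add: subgroup_self)
next
  case (Suc k)
  let ?E = "envelope G H k"
  let ?K = "G\<lparr>carrier := ?E\<rparr>"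
  have E: "subgroup ?E G" and HE: "H \<subseteq> carrier ?K"
    and eq: "\<And>j. j \<le> k \<Longrightarrow> iterated_centralizer ?K H j = upper_central ?K j"
    using Suc.IH by simp_all
  interpret K: group ?K
    by (rule subgroup_imp_group[OF E])
  have "iterated_centralizer ?K H (Suc k) \<subseteq> ?E"
    using K.iterated_centralizer_Suc[of k H, OF eq] by (auto simp: centralizer_mod_def)
  then have F: "envelope G H (Suc k) =
      centralizer_mod ?K (upper_central ?K k) (iterated_centralizer ?K H (Suc k))"
    by (intro envelope_Suc_eq_centralizer_mod eq E order_refl)
  have "subgroup (envelope G H (Suc k)) ?K"
    unfolding F by (rule K.iterated_centralizer_centralizer_mod(1)[OF HE]) (rule eq)
  then have "subgroup (envelope G H (Suc k)) G"
    by (rule incl_subgroup[OF E])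
  moreover have "H \<subseteq> envelope G H (Suc k)"
    unfolding F by (rule K.iterated_centralizer_centralizer_mod(2)[OF HE]) (rule eq)
  moreover have "iterated_centralizer (G\<lparr>carrier := envelope G H (Suc k)\<rparr>) H j =
      upper_central (G\<lparr>carrier := envelope G H (Suc k)\<rparr>) j" if "j \<le> Suc k" for j
    using K.iterated_centralizer_centralizer_mod(3)[OF HE _ that] eq
    unfolding F by (simp del: iterated_centralizer.simps upper_central.simps)
  ultimately show ?case
    by blast
qed

end

section \<open>Closedness\<close>

locale group_with_continuous_conjugation = group G
  for G (structure) and T :: "'a topology" +
  assumes topspace_eq: "topspace T = carrier G"
    and right_translation_continuous:
      "\<And>a. a \<in> carrier G \<Longrightarrow> continuous_map T T (\<lambda>x. x \<otimes> a)"
    and conjugation_continuous: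
      "\<And>a. a \<in> carrier G \<Longrightarrow> continuous_map T T (\<lambda>x. inv x \<otimes> a \<otimes> x)"
begin

lemma commutator_continuous:
  assumes "s \<in> carrier G"
  shows "continuous_map T T (\<lambda>x. commutator G x s)"
  using continuous_map_compose[OF conjugation_continuous right_translation_continuous,
      of "inv s" s] assms
  by (simp add: commutator_def o_def)

lemma closedin_centralizer_mod:
  assumes "closedin T N" "S \<subseteq> carrier G"
  shows "closedin T (centralizer_mod G N S)"
proof (cases "S = {}")
  case True
  then show ?thesis
    using closedin_topspace[of T] by (simp add: centralizer_mod_def topspace_eq)
next
  case False
  then have "centralizer_mod G N S = (\<Inter>s\<in>S. {x \<in> topspace T. commutator G x s \<in> N})"
    by (auto simp: centralizer_mod_def topspace_eq)
  then show ?thesis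
    using False assms closedin_continuous_map_preimage[OF commutator_continuous]
    by (auto intro!: closedin_INT)
qed

lemma closedin_centralizer_mod_restrict:
  assumes "subgroup E G" "closedin T E" "closedin T N" "S \<subseteq> E"
  shows "closedin T (centralizer_mod (G\<lparr>carrier := E\<rparr>) N S)"
  using assms subgroup.subset[OF assms(1)]
  by (auto simp: centralizer_mod_restrict intro!: closedin_Int closedin_centralizer_mod)

lemma closedin_upper_central:
  assumes "subgroup E G" "closedin T E" "closedin T {\<one>}"
  shows "closedin T (upper_central (G\<lparr>carrier := E\<rparr>) n)"
  using assms by (induction n) (simp_all add: closedin_centralizer_mod_restrict)

lemma closedin_envelope:
  assumes "subgroup H G" "closedin T {\<one>}"
  shows "closedin T (envelope G H k)"
proof (induction k)
  case 0
  then show ?case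
    using closedin_topspace[of T] by (simp add: topspace_eq)
next
  case (Suc k)
  let ?K = "G\<lparr>carrier := envelope G H k\<rparr>"
  have E: "subgroup (envelope G H k) G"
    and eq: "\<And>j. j \<le> k \<Longrightarrow> iterated_centralizer ?K H j = upper_central ?K j"
    using envelope_invariant[OF assms(1), of k] by auto
  have C: "iterated_centralizer ?K H (Suc k) \<subseteq> envelope G H k"
    using group.iterated_centralizer_Suc[OF subgroup_imp_group[OF E] eq, of k]
    by (auto simp: centralizer_mod_def)
  show ?case
    unfolding envelope_Suc_eq_centralizer_mod[OF eq[OF order_refl] E C]
    by (intro closedin_centralizer_mod_restrict closedin_upper_central E Suc.IH assms(2) C)
qed

end

theorem corollary3p2p3:
  fixes G :: "('a, 'b) monoid_scheme" and T :: "'a topology" and H :: "'a set"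
  assumes "group G"
    and "topspace T = carrier G"
    and "\<And>a. a \<in> carrier G \<Longrightarrow> closedin T {a}"
    and "continuous_map T T (\<lambda>x. inv\<^bsub>G\<^esub> x)"
    and "\<And>a. a \<in> carrier G \<Longrightarrow> continuous_map T T (\<lambda>x. a \<otimes>\<^bsub>G\<^esub> x)"
    and "\<And>a. a \<in> carrier G \<Longrightarrow> continuous_map T T (\<lambda>x. x \<otimes>\<^bsub>G\<^esub> a)"
    and "\<And>a. a \<in> carrier G \<Longrightarrow> continuous_map T T (\<lambda>x. inv\<^bsub>G\<^esub> x \<otimes>\<^bsub>G\<^esub> a \<otimes>\<^bsub>G\<^esub> x)"
    and "subgroup H G"
    and "min_condition_closed_subgroups G T"
  shows "\<exists>n. \<forall>m\<ge>n. envelope G H m = envelope G H n"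
proof -
  interpret group_with_continuous_conjugation G T
    using assms(1,2,6,7)
    by (simp add: group_with_continuous_conjugation_def group_with_continuous_conjugation_axioms_def)
  have "subgroup (envelope G H n) G \<and> closedin T (envelope G H n)" for n
    using envelope_invariant[OF assms(8)] closedin_envelope[OF assms(8) assms(3)] by simp
  moreover have "envelope G H (Suc n) \<subseteq> envelope G H n" for n
    by auto
  ultimately show ?thesis
    using assms(9) unfolding min_condition_closed_subgroups_def by blast
qed

end
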